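(* Let $R$ be a commutative ring with nonzero identity and with Jacobson radical $M$. The following statements are equivalent. (1) Each proper principal ideal of $R$ has an $OA$-factorization. (2) $R$ is a $\pi$-ring or an $OAF$-ring. (3) $R$ satisfies one of the following conditions. (A) $R$ is a $\pi$-ring. (B) $R$ is a local domain, $M^2$ is divided and $\bigcap_{n\in\mathbb{N}} M^n=\{0\}$. (C) $R$ is local, $M^2$ is divided and $M$ is nilpotent.
   Context: All rings are commutative with nonzero identity; $\mathbb{N}$ is the set of positive integers. Local means having exactly one maximal ideal (no Noetherian assumption). An ideal $I$ of $R$ is proper if $I\neq R$. A proper ideal $I$ of $R$ is an $OA$-ideal ($1$-absorbing prime ideal) if whenever $a,b,c\in R$ are nonunits with $abc\in I$, then $ab\in I$ or $c\in I$. An $OA$-factorization of a proper ideal $I$ is an expression $I=\prod_{i=1}^n J_i$ ($n\ge 1$) as a product of $OA$-ideals $J_i$. A ring is an $OAF$-ring if every proper ideal has an $OA$-factorization. A ring is a $\pi$-ring if every proper principal ideal is a finite product of prime ideals. An ideal $I$ of $R$ is divided if it is comparable under inclusion to every ideal of $R$. *)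

theory Defs
  imports "HOL-Algebra.Ideal_Product"
begin

definition proper_ideal :: "'a set \<Rightarrow> ('a, 'b) ring_scheme \<Rightarrow> bool"
  where "proper_ideal I R \<longleftrightarrow> ideal I R \<and> I \<noteq> carrier R"

definition OA_ideal :: "'a set \<Rightarrow> ('a, 'b) ring_scheme \<Rightarrow> bool"
  where "OA_ideal I R \<longleftrightarrow> proper_ideal I R \<and>
    (\<forall>a \<in> carrier R - Units R. \<forall>b \<in> carrier R - Units R. \<forall>c \<in> carrier R - Units R.
       a \<otimes>\<^bsub>R\<^esub> b \<otimes>\<^bsub>R\<^esub> c \<in> I \<longrightarrow> a \<otimes>\<^bsub>R\<^esub> b \<in> I \<or> c \<in> I)"

text \<open>Products and powers of ideals are taken in the monoid \<^const>\<open>ideals_set\<close>, whose unit is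
  the whole ring; hence the requirement that a factorization be nonempty.\<close>

definition ideal_list_prod :: "('a, 'b) ring_scheme \<Rightarrow> 'a set list \<Rightarrow> 'a set"
  where "ideal_list_prod R Js = foldr (\<otimes>\<^bsub>ideals_set R\<^esub>) Js \<one>\<^bsub>ideals_set R\<^esub>"

definition has_OA_factorization :: "('a, 'b) ring_scheme \<Rightarrow> 'a set \<Rightarrow> bool"
  where "has_OA_factorization R I \<longleftrightarrow>
    (\<exists>Js. Js \<noteq> [] \<and> (\<forall>J \<in> set Js. OA_ideal J R) \<and> I = ideal_list_prod R Js)"

definition has_prime_factorization :: "('a, 'b) ring_scheme \<Rightarrow> 'a set \<Rightarrow> bool"
  where "has_prime_factorization R I \<longleftrightarrow>
    (\<exists>Js. Js \<noteq> [] \<and> (\<forall>J \<in> set Js. primeideal J R) \<and> I = ideal_list_prod R Js)"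

definition OAF_ring :: "('a, 'b) ring_scheme \<Rightarrow> bool"
  where "OAF_ring R \<longleftrightarrow> (\<forall>I. proper_ideal I R \<longrightarrow> has_OA_factorization R I)"

definition pi_ring :: "('a, 'b) ring_scheme \<Rightarrow> bool"
  where "pi_ring R \<longleftrightarrow>
    (\<forall>I. proper_ideal I R \<and> principalideal I R \<longrightarrow> has_prime_factorization R I)"

definition local_ring :: "('a, 'b) ring_scheme \<Rightarrow> bool"
  where "local_ring R \<longleftrightarrow> (\<exists>!N. maximalideal N R)"

definition divided_ideal :: "'a set \<Rightarrow> ('a, 'b) ring_scheme \<Rightarrow> bool"
  where "divided_ideal I R \<longleftrightarrow> ideal I R \<and> (\<forall>J. ideal J R \<longrightarrow> I \<subseteq> J \<or> J \<subseteq> I)"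

definition nilpotent_ideal :: "'a set \<Rightarrow> ('a, 'b) ring_scheme \<Rightarrow> bool"
  where "nilpotent_ideal I R \<longleftrightarrow>
    ideal I R \<and> (\<exists>n::nat. n \<ge> 1 \<and> I [^]\<^bsub>ideals_set R\<^esub> n = {\<zero>\<^bsub>R\<^esub>})"

text \<open>Intersecting with the carrier only matters for the zero ring, which has no maximal ideals.\<close>

definition jacobson_radical :: "('a, 'b) ring_scheme \<Rightarrow> 'a set"
  where "jacobson_radical R = carrier R \<inter> \<Inter>{N. maximalideal N R}"

end

theory Submission
  imports Defs "HOL-Algebra.Ring_Divisibility"
begin

text \<open>If \<open>R\<close> is not local, its OA-ideals are the prime ideals. If \<open>R\<close> is local with maximal ideal
  \<open>M\<close>, they are the prime ideals together with the ideals between \<open>M \<cdot> M\<close> and \<open>M\<close>. So if proper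
  principal ideals factor, then every \<open>a \<in> M\<close> outside \<open>M \<cdot> M\<close> generates an ideal that is prime or
  contains \<open>M \<cdot> M\<close>, and the same alternative can be taken for all such \<open>a\<close>. If these ideals are all
  prime, every OA-factor of a principal ideal can be replaced by prime ones, and \<open>R\<close> is a \<open>\<pi>\<close>-ring.
  Otherwise \<open>M \<cdot> M\<close> is divided, each nonmaximal prime \<open>P\<close> satisfies \<open>P = M \<cdot> P\<close>, and Nakayama's
  lemma, applied to factored principal ideals, kills the intersection of the powers of \<open>M\<close>; a
  factorization of \<open>{\<zero>}\<close> then shows that \<open>R\<close> is a domain or \<open>M\<close> is nilpotent. Conversely, if
  \<open>M \<cdot> M\<close> is divided and \<open>x \<in> M\<close> lies outside it, then \<open>M \<cdot> M = (PIdl x) \<cdot> M\<close>, which lets one split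
  off factors \<open>PIdl x\<close> from an ideal until the rest is not contained in \<open>M \<cdot> M\<close>, hence contains it.\<close>

context cring
begin

section \<open>Principal ideals and products of ideals\<close>

lemma mem_cgenideal_iff: "x \<in> PIdl a \<longleftrightarrow> (\<exists>r\<in>carrier R. x = r \<otimes> a)"
  by (auto simp: cgenideal_def)

lemma cgenideal_subset_iff:
  assumes "ideal I R" "a \<in> carrier R"
  shows "PIdl a \<subseteq> I \<longleftrightarrow> a \<in> I"
  using assms cgenideal_minimal cgenideal_self by blast

lemma principalideal_iff: "principalideal I R \<longleftrightarrow> (\<exists>a\<in>carrier R. I = PIdl a)"
proof
  assume "principalideal I R"
  then show "\<exists>a\<in>carrier R. I = PIdl a"
    using principalideal.generate cgenideal_eq_genideal by metis
qed (auto intro: cgenideal_is_principalideal)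

lemma ideal_subset_carrier: "ideal I R \<Longrightarrow> I \<subseteq> carrier R"
  using ideal.Icarr by fast

lemma ideal_diff_closed:
  assumes "ideal I R" "x \<in> I" "y \<in> I"
  shows "x \<ominus> y \<in> I"
  using assms additive_subgroup.a_closed[OF ideal.axioms(1)[OF assms(1)]]
    additive_subgroup.a_inv_closed[OF ideal.axioms(1)[OF assms(1)]]
  by (simp add: a_minus_def)

lemma ideal_add_closed:
  assumes "ideal I R" "x \<in> I" "y \<in> I"
  shows "x \<oplus> y \<in> I"
  by (rule additive_subgroup.a_closed[OF ideal.axioms(1)[OF assms(1)] assms(2,3)])

lemma ideal_zero_closed: "ideal I R \<Longrightarrow> \<zero> \<in> I"
  by (rule additive_subgroup.zero_closed[OF ideal.axioms(1)])

lemma ideal_cancel_unit: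
  assumes "ideal I R" "x \<in> carrier R" "u \<in> Units R" "x \<otimes> u \<in> I"
  shows "x \<in> I"
proof -
  have "x \<otimes> u \<otimes> inv u \<in> I"
    using ideal.I_r_closed[OF assms(1,4)] assms(3) by blast
  then show ?thesis
    using assms Units_closed by (simp add: m_assoc)
qed

lemma ideal_prod_subsetI:
  assumes "ideal K R" "\<And>i j. i \<in> I \<Longrightarrow> j \<in> J \<Longrightarrow> i \<otimes> j \<in> K"
  shows "I \<cdot> J \<subseteq> K"
proof
  fix x assume "x \<in> I \<cdot> J"
  then show "x \<in> K"
    by induct (auto intro: assms ideal_add_closed)
qed

lemma ideal_prod_mono:
  assumes "ideal I' R" "ideal J' R" "I \<subseteq> I'" "J \<subseteq> J'"
  shows "I \<cdot> J \<subseteq> I' \<cdot> J'"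
  using assms by (intro ideal_prod_subsetI ideal_prod_is_ideal) (auto intro: ideal_prod.prod)

text \<open>Sums of products collapse because \<open>a\<close> can be factored out, so ideals of
  this form are handled elementwise.\<close>

lemma mem_cgenideal_prod_iff:
  assumes "ideal I R" "a \<in> carrier R"
  shows "x \<in> (PIdl a) \<cdot> I \<longleftrightarrow> (\<exists>i\<in>I. x = a \<otimes> i)"
proof
  assume "x \<in> (PIdl a) \<cdot> I"
  then show "\<exists>i\<in>I. x = a \<otimes> i"
  proof induct
    case (prod u i)
    then obtain r where r: "r \<in> carrier R" "u = r \<otimes> a"
      by (auto simp: mem_cgenideal_iff)
    have "i \<in> carrier R"
      using ideal.Icarr[OF assms(1) prod(2)] .
    then have "u \<otimes> i = a \<otimes> (r \<otimes> i)"
      using r assms(2) by (simp add: m_lcomm m_assoc)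
    moreover have "r \<otimes> i \<in> I"
      using ideal.I_l_closed[OF assms(1) prod(2) r(1)] .
    ultimately show ?case by blast
  next
    case (sum s t)
    then obtain i j where ij: "i \<in> I" "j \<in> I" "s = a \<otimes> i" "t = a \<otimes> j" by blast
    then have "s \<oplus> t = a \<otimes> (i \<oplus> j)"
      using assms(2) ideal.Icarr[OF assms(1)] by (simp add: r_distr)
    then show ?case
      using ideal_add_closed[OF assms(1) ij(1,2)] by blast
  qed
next
  assume "\<exists>i\<in>I. x = a \<otimes> i"
  then show "x \<in> (PIdl a) \<cdot> I"
    using cgenideal_self[OF assms(2)] by (auto intro: ideal_prod.prod)
qed

lemma mult_mem_cgenideal_prod:
  assumes "ideal I R" "a \<in> carrier R" "i \<in> I"
  shows "i \<otimes> a \<in> (PIdl a) \<cdot> I"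
proof -
  have "i \<otimes> a = a \<otimes> i"
    using assms ideal.Icarr by (intro m_comm) auto
  then show ?thesis
    using mem_cgenideal_prod_iff[OF assms(1,2)] assms(3) by blast
qed

text \<open>Division by \<open>a\<close>: the witness is the colon ideal of \<open>I\<close> by
  \<open>a\<close>, cut down to \<open>K\<close>. The bound \<open>J \<subseteq> K\<close> drives
  the induction in \<open>divided_OA_factorization\<close>.\<close>

lemma ideal_subset_cgenideal_prodE:
  assumes "ideal I R" "ideal K R" "a \<in> carrier R" "I \<subseteq> (PIdl a) \<cdot> K"
  obtains J where "ideal J R" "J \<subseteq> K" "I = (PIdl a) \<cdot> J"
proof
  let ?J = "{j \<in> K. a \<otimes> j \<in> I}"
  have carr: "\<And>j. j \<in> K \<Longrightarrow> j \<in> carrier R"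
    using ideal.Icarr[OF assms(2)] .
  show J: "ideal ?J R"
  proof (rule idealI[OF ring_axioms])
    show "subgroup ?J (add_monoid R)"
    proof (unfold_locales, goal_cases)
      case 1
      then show ?case using carr by auto
    next
      case (2 x y)
      then show ?case
        using carr assms(3) by (auto simp: r_distr intro: ideal_add_closed assms)
    next
      case 3
      then show ?case
        using assms(3) ideal_zero_closed[OF assms(1)] ideal_zero_closed[OF assms(2)] by simp
    next
      case (4 x)
      then show ?case
        using carr assms(3) additive_subgroup.a_inv_closed[OF ideal.axioms(1)[OF assms(1)]]
          additive_subgroup.a_inv_closed[OF ideal.axioms(1)[OF assms(2)]]
        by (auto simp: a_inv_def[symmetric] r_minus)
    qed
    show "x \<otimes> j \<in> ?J" if "j \<in> ?J" "x \<in> carrier R" for j x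
    proof -
      have "a \<otimes> (x \<otimes> j) = x \<otimes> (a \<otimes> j)"
        using that carr assms(3) by (intro m_lcomm) auto
      then show ?thesis
        using that ideal.I_l_closed[OF assms(1)] ideal.I_l_closed[OF assms(2)] by auto
    qed
    then show "j \<otimes> x \<in> ?J" if "j \<in> ?J" "x \<in> carrier R" for j x
      using that carr by (metis (no_types, lifting) m_comm mem_Collect_eq)
  qed
  show "?J \<subseteq> K" by blast
  show "I = (PIdl a) \<cdot> ?J"
  proof
    show "I \<subseteq> (PIdl a) \<cdot> ?J"
    proof
      fix x assume x: "x \<in> I"
      then obtain k where "k \<in> K" "x = a \<otimes> k"
        using assms(4) mem_cgenideal_prod_iff[OF assms(2,3)] by blast
      then show "x \<in> (PIdl a) \<cdot> ?J"
        using x mem_cgenideal_prod_iff[OF J assms(3)] by blast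
    qed
    show "(PIdl a) \<cdot> ?J \<subseteq> I"
      using mem_cgenideal_prod_iff[OF J assms(3)] by auto
  qed
qed

section \<open>Finite products and powers of ideals\<close>

lemma ideal_prod_one_left: "ideal I R \<Longrightarrow> carrier R \<cdot> I = I"
  using ideal_prod_commute ideal_prod_one oneideal by metis

lemma ideal_list_prod_Nil: "ideal_list_prod R [] = carrier R"
  by (simp add: ideal_list_prod_def ideals_set_def)

lemma ideal_list_prod_Cons: "ideal_list_prod R (J # Js) = J \<cdot> ideal_list_prod R Js"
  by (simp add: ideal_list_prod_def ideals_set_def)

lemmas ideal_list_prod_simps = ideal_list_prod_Nil ideal_list_prod_Cons

lemma ideal_list_prod_ideal: "(\<And>J. J \<in> set Js \<Longrightarrow> ideal J R) \<Longrightarrow> ideal (ideal_list_prod R Js) R"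
  by (induct Js) (simp_all add: ideal_list_prod_simps oneideal ideal_prod_is_ideal)

lemma ideal_list_prod_single: "ideal J R \<Longrightarrow> ideal_list_prod R [J] = J"
  by (simp add: ideal_list_prod_simps ideal_prod_one)

lemma ideal_list_prod_subset:
  assumes "\<And>J. J \<in> set Js \<Longrightarrow> ideal J R" "J \<in> set Js"
  shows "ideal_list_prod R Js \<subseteq> J"
  using assms
proof (induct Js)
  case (Cons K Js)
  then have "K \<cdot> ideal_list_prod R Js \<subseteq> K \<inter> ideal_list_prod R Js"
    by (intro ideal_prod_inter ideal_list_prod_ideal) auto
  then show ?case
    using Cons by (auto simp: ideal_list_prod_Cons)
qed simp

abbreviation ipow :: "'a set \<Rightarrow> nat \<Rightarrow> 'a set"
  where "ipow I n \<equiv> I [^]\<^bsub>ideals_set R\<^esub> n"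

lemma ideal_pow_0: "ipow I 0 = carrier R"
  by (simp add: ideals_set_def)

lemma ideal_pow_Suc: "ipow I (Suc n) = ipow I n \<cdot> I"
  by (simp add: ideals_set_def)

lemma ideal_pow_ideal: "ideal I R \<Longrightarrow> ideal (ipow I n) R"
  by (induct n) (simp_all only: ideal_pow_0 ideal_pow_Suc oneideal ideal_prod_is_ideal)

lemma ideal_pow_1: "ideal I R \<Longrightarrow> ipow I 1 = I"
  by (simp only: One_nat_def ideal_pow_0 ideal_pow_Suc ideal_prod_one_left)

lemma ideal_pow_2: "ideal I R \<Longrightarrow> ipow I 2 = I \<cdot> I"
  by (simp only: numeral_2_eq_2 ideal_pow_0 ideal_pow_Suc ideal_prod_one_left)

lemma ideal_pow_add:
  assumes "ideal I R"
  shows "ipow I m \<cdot> ipow I n = ipow I (m + n)"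
proof -
  interpret ideals: comm_monoid "ideals_set R"
    by (rule ideals_set_is_comm_monoid)
  show ?thesis
    using ideals.nat_pow_mult[of I m n] assms by (simp add: ideals_set_def)
qed

section \<open>Proper and maximal ideals\<close>

lemma proper_ideal_iff: "proper_ideal I R \<longleftrightarrow> ideal I R \<and> \<one> \<notin> I"
  unfolding proper_ideal_def
  using ideal.one_imp_carrier by (metis one_closed)

lemma proper_ideal_nonunit:
  assumes "proper_ideal I R" "x \<in> I"
  shows "x \<notin> Units R"
proof
  assume "x \<in> Units R"
  then have "inv x \<otimes> x \<in> I"
    using assms Units_inv_closed ideal.I_l_closed unfolding proper_ideal_def by metis
  then show False
    using assms \<open>x \<in> Units R\<close> by (simp add: proper_ideal_iff Units_l_inv)
qed

lemma proper_cgenideal: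
  assumes "x \<in> carrier R" "x \<notin> Units R"
  shows "proper_ideal (PIdl x) R"
proof -
  have "\<one> \<notin> PIdl x"
  proof
    assume "\<one> \<in> PIdl x"
    then obtain r where "r \<in> carrier R" "r \<otimes> x = \<one>"
      by (auto simp: mem_cgenideal_iff)
    then show False
      using assms by (metis (mono_tags, lifting) Units_def m_comm mem_Collect_eq)
  qed
  then show ?thesis
    using cgenideal_ideal assms by (simp add: proper_ideal_iff)
qed

text \<open>Krull's theorem by Zorn's lemma: the union of a chain of proper ideals is proper because
  \<open>\<one>\<close> lies in none of them.\<close>

lemma proper_ideal_subset_maximalideal:
  assumes "proper_ideal I R"
  obtains N where "maximalideal N R" "I \<subseteq> N"
proof -
  let ?A = "{J. proper_ideal J R \<and> I \<subseteq> J}"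
  have "\<exists>N\<in>?A. \<forall>X\<in>?A. N \<subseteq> X \<longrightarrow> X = N"
  proof (rule subset_Zorn_nonempty)
    show "?A \<noteq> {}"
      using assms by blast
    fix C assume C: "C \<noteq> {}" "subset.chain ?A C"
    then have "subset.chain {J. ideal J R} C"
      by (auto simp: pred_on.chain_def proper_ideal_def)
    then have "ideal (\<Union>C) R"
      using chain_Union_is_ideal[of C] C(1) by simp
    moreover have "\<one> \<notin> J" "I \<subseteq> J" if "J \<in> C" for J
      using C(2) that by (auto simp: pred_on.chain_def proper_ideal_iff)
    ultimately show "\<Union>C \<in> ?A"
      using C(1) by (simp add: proper_ideal_iff) blast
  qed
  then obtain N where "N \<in> ?A" and max: "\<forall>X\<in>?A. N \<subseteq> X \<longrightarrow> X = N"
    by (rule bexE)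
  then have N: "proper_ideal N R" "I \<subseteq> N"
    by simp_all
  have "maximalideal N R"
  proof (rule maximalidealI)
    show "ideal N R" "carrier R \<noteq> N"
      using N(1) by (auto simp: proper_ideal_def)
    fix J assume J: "ideal J R" "N \<subseteq> J"
    show "J = N \<or> J = carrier R"
    proof (rule disjCI)
      assume "J \<noteq> carrier R"
      then have "J \<in> ?A"
        using J N(2) by (simp add: proper_ideal_def)
      then show "J = N"
        using max J(2) by simp
    qed
  qed
  then show thesis
    using that N(2) by blast
qed

section \<open>OA-ideals, and the nonlocal case\<close>

lemma primeideal_proper: "primeideal P R \<Longrightarrow> proper_ideal P R"
  by (simp add: proper_ideal_def primeideal_def primeideal_axioms_def) blast

lemma primeideal_imp_OA_ideal:
  assumes "primeideal P R"
  shows "OA_ideal P R"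
  unfolding OA_ideal_def
  using primeideal_proper[OF assms] primeideal.I_prime[OF assms] by auto

lemma has_prime_factorization_imp_OA: "has_prime_factorization R I \<Longrightarrow> has_OA_factorization R I"
  unfolding has_prime_factorization_def has_OA_factorization_def
  using primeideal_imp_OA_ideal by blast

lemma OA_ideal_has_OA_factorization:
  assumes "OA_ideal J R"
  shows "has_OA_factorization R J"
proof -
  have "J = ideal_list_prod R [J]"
    using assms ideal_list_prod_single by (simp add: OA_ideal_def proper_ideal_def)
  then show ?thesis
    unfolding has_OA_factorization_def using assms by (intro exI[of _ "[J]"]) simp
qed

lemma has_OA_factorization_Cons:
  assumes "OA_ideal J R" "has_OA_factorization R I"
  shows "has_OA_factorization R (J \<cdot> I)"
proof -
  obtain Js where "\<forall>K\<in>set Js. OA_ideal K R" "I = ideal_list_prod R Js"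
    using assms(2) by (auto simp: has_OA_factorization_def)
  then show ?thesis
    unfolding has_OA_factorization_def using assms(1)
    by (intro exI[of _ "J # Js"]) (simp add: ideal_list_prod_Cons)
qed

text \<open>Neither \<open>a\<close> nor \<open>b\<close> is a unit, since a unit could be cancelled
  from \<open>a \<otimes> b \<in> J\<close>. So the OA condition applies to the triple
  \<open>x\<close>, \<open>a\<close>, \<open>b\<close>, and \<open>b \<notin> J\<close> leaves
  \<open>x \<otimes> a \<in> J\<close>.\<close>

lemma OA_ideal_mult_nonunit:
  assumes J: "OA_ideal J R"
    and ab: "a \<in> carrier R" "b \<in> carrier R" "a \<notin> J" "b \<notin> J" "a \<otimes> b \<in> J"
    and x: "x \<in> carrier R - Units R"
  shows "x \<otimes> a \<in> J"
proof -
  have id: "ideal J R" and pr: "proper_ideal J R"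
    using J by (auto simp: OA_ideal_def proper_ideal_def)
  have aux: "v \<notin> Units R" if "u \<in> carrier R" "u \<notin> J" "u \<otimes> v \<in> J" for u v
    using ideal_cancel_unit[OF id that(1)] that by blast
  have "b \<notin> Units R" "a \<notin> Units R"
    using aux[of a b] aux[of b a] ab by (auto simp: m_comm)
  moreover have "x \<otimes> a \<otimes> b \<in> J"
    using x ab ideal.I_l_closed[OF id ab(5)] by (simp add: m_assoc)
  ultimately show ?thesis
    using J ab x unfolding OA_ideal_def by blast
qed

text \<open>Here two nonunits \<open>x\<close> and \<open>y\<close> have a unit as their sum, and \<open>OA_ideal_mult_nonunit\<close>
  applies to both of them.\<close>

lemma not_local_OA_ideal_imp_primeideal:
  assumes nl: "\<not> ideal (carrier R - Units R) R" and ne: "\<one> \<noteq> \<zero>"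
    and J: "OA_ideal J R"
  shows "primeideal J R"
proof -
  have id: "ideal J R" and pr: "proper_ideal J R"
    using J by (auto simp: OA_ideal_def proper_ideal_def)
  let ?N = "carrier R - Units R"
  have mul: "x \<otimes> a \<in> ?N" if "a \<in> ?N" "x \<in> carrier R" for a x
    using that proper_ideal_nonunit[OF proper_cgenideal[of a]]
    by (auto simp: mem_cgenideal_iff)
  \<comment> \<open>Otherwise the nonunits would be closed under addition and form an ideal, against
    \<open>nl\<close>.\<close>
  have "\<exists>x\<in>?N. \<exists>y\<in>?N. x \<oplus> y \<in> Units R"
  proof (rule ccontr)
    assume H: "\<not> ?thesis"
    have "ideal ?N R"
    proof (rule idealI[OF ring_axioms])
      show "subgroup ?N (add_monoid R)"
      proof (unfold_locales, goal_cases)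
        case 1
        then show ?case by auto
      next
        case (2 x y)
        then show ?case using H by auto
      next
        case 3
        then show ?case using ne by (auto simp: Units_def)
      next
        case (4 x)
        then have "\<ominus> \<one> \<otimes> x \<in> ?N" by (intro mul) auto
        then show ?case using 4 by (simp add: a_inv_def[symmetric] l_minus)
      qed
      show "x \<otimes> a \<in> ?N" "a \<otimes> x \<in> ?N" if "a \<in> ?N" "x \<in> carrier R" for a x
        using mul[OF that] that by (auto simp: m_comm)
    qed
    then show False using nl by blast
  qed
  then obtain x y where xy: "x \<in> ?N" "y \<in> ?N" "x \<oplus> y \<in> Units R" by blast
  show ?thesis
  proof (rule primeidealI[OF id is_cring])
    show "carrier R \<noteq> J" using pr by (auto simp: proper_ideal_def)
    fix a b assume ab: "a \<in> carrier R" "b \<in> carrier R" "a \<otimes> b \<in> J"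
    show "a \<in> J \<or> b \<in> J"
    proof (rule ccontr)
      assume "\<not> ?thesis"
      then have "x \<otimes> a \<in> J" "y \<otimes> a \<in> J"
        using OA_ideal_mult_nonunit[OF J ab(1,2) _ _ ab(3)] xy by blast+
      then have "(x \<oplus> y) \<otimes> a \<in> J"
        using ideal_add_closed[OF id] xy ab by (metis DiffD1 l_distr)
      then have "a \<otimes> (x \<oplus> y) \<in> J"
        using ab xy by (simp add: m_comm)
      then have "a \<in> J"
        using ideal_cancel_unit[OF id ab(1) xy(3)] by blast
      then show False using \<open>\<not> (a \<in> J \<or> b \<in> J)\<close> by blast
    qed
  qed
qed

end

section \<open>Local rings and their OA-ideals\<close>

text \<open>Locality is encoded by the nonunits forming an ideal, which gives an elementwise test
  for membership in \<open>M\<close>. \<open>local_ring_iff\<close> links this to uniqueness of the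
  maximal ideal.\<close>

locale local_cring = cring R for R (structure) +
  fixes M
  assumes M_eq: "M = carrier R - Units R"
    and ideal_M: "ideal M R"
begin

lemma M_carrier: "x \<in> M \<Longrightarrow> x \<in> carrier R"
  by (simp add: M_eq)

lemma one_notin_M: "\<one> \<notin> M"
  by (simp add: M_eq)

lemma Units_iff: "x \<in> carrier R \<Longrightarrow> x \<in> Units R \<longleftrightarrow> x \<notin> M"
  by (simp add: M_eq)

lemma proper_ideal_subset_M: "proper_ideal I R \<Longrightarrow> I \<subseteq> M"
  using proper_ideal_nonunit[of I] ideal.Icarr[of I R] by (auto simp: M_eq proper_ideal_def)

lemma maximalideal_M: "maximalideal M R"
proof (rule maximalidealI[OF ideal_M])
  show "carrier R \<noteq> M" using one_notin_M by auto
  fix J assume "ideal J R" "M \<subseteq> J" "J \<subseteq> carrier R"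
  then show "J = M \<or> J = carrier R"
    using proper_ideal_subset_M[of J] by (auto simp: proper_ideal_def)
qed

lemma primeideal_M: "primeideal M R"
  using maximalideal_prime[OF maximalideal_M] .

lemma maximalideal_iff: "maximalideal N R \<longleftrightarrow> N = M"
proof
  assume N: "maximalideal N R"
  then interpret maximalideal N R .
  have "N \<subseteq> M"
    using proper_ideal_subset_M[of N] is_ideal I_notcarr by (auto simp: proper_ideal_def)
  then show "N = M"
    using I_maximal[OF ideal_M] M_carrier one_notin_M by auto
qed (simp add: maximalideal_M)

lemma jacobson_radical_eq: "jacobson_radical R = M"
  using M_carrier by (auto simp: jacobson_radical_def maximalideal_iff)

lemma local_ring: "local_ring R"
  by (simp add: local_ring_def maximalideal_iff)

lemma ideal_MM: "ideal (M \<cdot> M) R"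
  using ideal_M by (rule ideal_prod_is_ideal[OF _ ideal_M])

lemma MM_subset: "M \<cdot> M \<subseteq> M"
  using ideal_prod_inter[OF ideal_M ideal_M] by blast

lemma mult_MM: "x \<in> M \<Longrightarrow> y \<in> M \<Longrightarrow> x \<otimes> y \<in> M \<cdot> M"
  by (rule ideal_prod.prod)

lemma one_minus_Units:
  assumes "m \<in> M"
  shows "\<one> \<ominus> m \<in> Units R"
proof -
  have m: "m \<in> carrier R" using assms M_carrier by blast
  have "\<one> \<ominus> m \<notin> M"
  proof
    assume "\<one> \<ominus> m \<in> M"
    then have "(\<one> \<ominus> m) \<oplus> m \<in> M"
      using assms ideal_add_closed[OF ideal_M] by blast
    moreover have "(\<one> \<ominus> m) \<oplus> m = \<one>"
      using m by algebra
    ultimately show False using one_notin_M by simp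
  qed
  then show ?thesis
    using m by (simp add: Units_iff)
qed

text \<open>The cyclic case of Nakayama's lemma: the unit \<open>\<one> \<ominus> m\<close> kills
  \<open>y\<close>.\<close>

lemma eq_zero_if_eq_mult_M:
  assumes "y \<in> carrier R" "m \<in> M" "y = y \<otimes> m"
  shows "y = \<zero>"
proof -
  have m: "m \<in> carrier R" using assms M_carrier by blast
  have "y \<otimes> (\<one> \<ominus> m) = y \<ominus> y \<otimes> m"
    using m assms(1) by algebra
  also have "\<dots> = \<zero>"
    using assms(1,3) m by (metis a_minus_def r_neg)
  finally have "y \<otimes> (\<one> \<ominus> m) \<in> {\<zero>}" by simp
  then show ?thesis
    using ideal_cancel_unit[OF zeroideal assms(1) one_minus_Units[OF assms(2)]] by simp
qed

lemma eq_zero_if_mem_cgenideal_prod_M: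
  assumes "y \<in> carrier R" "y \<in> (PIdl y) \<cdot> M"
  shows "y = \<zero>"
  using assms mem_cgenideal_prod_iff[OF ideal_M assms(1)] eq_zero_if_eq_mult_M by blast

text \<open>If primality fails at \<open>a\<close> and \<open>b\<close>, then \<open>J\<close>
  contains every \<open>y \<otimes> a\<close> with \<open>y \<in> M\<close>, and \<open>a\<close> is
  a nonunit. The OA condition for \<open>x\<close>, \<open>y\<close>, \<open>a\<close> with
  \<open>a \<notin> J\<close> then puts \<open>x \<otimes> y\<close> into \<open>J\<close>.\<close>

lemma OA_ideal_cases:
  assumes "OA_ideal J R"
  shows "primeideal J R \<or> M \<cdot> M \<subseteq> J"
proof (rule disjCI)
  assume "\<not> M \<cdot> M \<subseteq> J"
  have id: "ideal J R" and pr: "proper_ideal J R"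
    using assms by (auto simp: OA_ideal_def proper_ideal_def)
  have M_Un: "carrier R - Units R = M" by (simp add: M_eq)
  show "primeideal J R"
  proof (rule primeidealI[OF id is_cring])
    show "carrier R \<noteq> J" using pr by (auto simp: proper_ideal_def)
    fix a b assume ab: "a \<in> carrier R" "b \<in> carrier R" "a \<otimes> b \<in> J"
    show "a \<in> J \<or> b \<in> J"
    proof (rule ccontr)
      assume n: "\<not> ?thesis"
      have xa: "x \<otimes> a \<in> J" if "x \<in> M" for x
        using OA_ideal_mult_nonunit[OF assms ab(1,2) _ _ ab(3)] n that M_Un by auto
      have "a \<in> M"
      proof (rule ccontr)
        assume "a \<notin> M"
        then have "a \<in> Units R" using ab by (simp add: Units_iff)
        then show False
          using n ab ideal_cancel_unit[OF id ab(2)] by (simp add: m_comm)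
      qed
      have "x \<otimes> y \<in> J" if "x \<in> M" "y \<in> M" for x y
      proof -
        have "x \<otimes> y \<otimes> a \<in> J"
          using ideal.I_l_closed[OF id xa[OF that(2)], of x] that M_carrier ab
          by (simp add: m_assoc)
        then show ?thesis
          using assms n that \<open>a \<in> M\<close> unfolding OA_ideal_def M_Un by blast
      qed
      then have "M \<cdot> M \<subseteq> J" by (intro ideal_prod_subsetI[OF id])
      then show False using \<open>\<not> M \<cdot> M \<subseteq> J\<close> by blast
    qed
  qed
qed

lemma OA_ideal_if_MM_subset:
  assumes "proper_ideal J R" "M \<cdot> M \<subseteq> J"
  shows "OA_ideal J R"
  unfolding OA_ideal_def using assms mult_MM by (auto simp: M_eq)

section \<open>From divided \<open>M \<cdot> M\<close> to OA-factorizations\<close>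

text \<open>As \<open>PIdl x\<close> contains \<open>x\<close>, dividedness puts
  \<open>M \<cdot> M\<close> inside it. In \<open>y = r \<otimes> x\<close> the cofactor is a
  nonunit, since a unit would bring \<open>x\<close> into \<open>M \<cdot> M\<close>.\<close>

lemma divided_imp_MM_eq:
  assumes "divided_ideal (M \<cdot> M) R" "x \<in> M" "x \<notin> M \<cdot> M"
  shows "M \<cdot> M = (PIdl x) \<cdot> M"
proof
  have x: "x \<in> carrier R" using assms M_carrier by blast
  have I: "ideal (PIdl x) R" using cgenideal_ideal[OF x] .
  have sub: "M \<cdot> M \<subseteq> PIdl x"
    using assms(1,3) I cgenideal_self[OF x] unfolding divided_ideal_def by blast
  show "M \<cdot> M \<subseteq> (PIdl x) \<cdot> M"
  proof
    fix y assume y: "y \<in> M \<cdot> M"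
    then obtain r where r: "r \<in> carrier R" "y = r \<otimes> x"
      using subsetD[OF sub y] by (auto simp: mem_cgenideal_iff)
    have "r \<in> M"
    proof (rule ccontr)
      assume "r \<notin> M"
      then have "r \<in> Units R" using r by (simp add: Units_iff)
      moreover have "x \<otimes> r \<in> M \<cdot> M" using y r x by (simp add: m_comm)
      ultimately show False
        using assms(3) ideal_cancel_unit[OF ideal_MM x] by blast
    qed
    then show "y \<in> (PIdl x) \<cdot> M"
      using mult_mem_cgenideal_prod[OF ideal_M x] r by simp
  qed
  show "(PIdl x) \<cdot> M \<subseteq> M \<cdot> M"
    using assms(2) x ideal_M by (intro ideal_prod_mono) (auto simp: cgenideal_subset_iff)
qed

text \<open>Here \<open>I\<close> has exact \<open>M\<close>-adic order \<open>Suc n\<close>. At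
  order one it lies between \<open>M \<cdot> M\<close> and \<open>M\<close>; dividing by
  \<open>x\<close> lowers the order by one.\<close>

lemma divided_OA_factorization:
  assumes div: "divided_ideal (M \<cdot> M) R" and x: "x \<in> M" "x \<notin> M \<cdot> M"
    and I: "ideal I R" "I \<subseteq> ipow M (Suc n)" "\<not> I \<subseteq> ipow M (Suc (Suc n))"
  shows "has_OA_factorization R I"
  using I
proof (induct n arbitrary: I)
  case 0
  have "ipow M (Suc 0) = M" "ipow M (Suc (Suc 0)) = M \<cdot> M"
    using ideal_pow_1[OF ideal_M] ideal_pow_2[OF ideal_M] by (simp_all add: numeral_2_eq_2)
  then have "I \<subseteq> M" "M \<cdot> M \<subseteq> I"
    using 0 div unfolding divided_ideal_def by auto
  then have "OA_ideal I R"
    using 0(1) one_notin_M by (intro OA_ideal_if_MM_subset) (auto simp: proper_ideal_iff)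
  then show ?case by (rule OA_ideal_has_OA_factorization)
next
  case (Suc n)
  have xc: "x \<in> carrier R" using x M_carrier by blast
  have X: "ideal (PIdl x) R" using cgenideal_ideal[OF xc] .
  have MM: "M \<cdot> M = (PIdl x) \<cdot> M" using divided_imp_MM_eq[OF div x] .
  \<comment> \<open>Multiplication by \<open>x\<close> leads from each positive power of
    \<open>M\<close> to the next.\<close>
  have pow: "ipow M (Suc (Suc k)) = (PIdl x) \<cdot> ipow M (Suc k)" for k
  proof -
    have "ipow M (Suc (Suc k)) = ipow M k \<cdot> (M \<cdot> M)"
      using ideal_M by (simp only: ideal_pow_Suc ideal_prod_assoc ideal_pow_ideal)
    also have "\<dots> = ((PIdl x) \<cdot> M) \<cdot> ipow M k"
      unfolding MM using ideal_M X by (intro ideal_prod_commute ideal_pow_ideal ideal_prod_is_ideal)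
    also have "\<dots> = (PIdl x) \<cdot> (M \<cdot> ipow M k)"
      using ideal_M X by (simp only: ideal_prod_assoc ideal_pow_ideal)
    also have "M \<cdot> ipow M k = ipow M (Suc k)"
      unfolding ideal_pow_Suc using ideal_M by (intro ideal_prod_commute ideal_pow_ideal)
    finally show ?thesis .
  qed
  obtain J where J: "ideal J R" "J \<subseteq> ipow M (Suc n)" "I = (PIdl x) \<cdot> J"
    using ideal_subset_cgenideal_prodE[OF Suc(2) ideal_pow_ideal[OF ideal_M] xc, of "Suc n"]
      Suc(3) pow by metis
  have "\<not> J \<subseteq> ipow M (Suc (Suc n))"
  proof
    assume "J \<subseteq> ipow M (Suc (Suc n))"
    then have "I \<subseteq> ipow M (Suc (Suc (Suc n)))"
      unfolding J(3) pow[of "Suc n"] using X ideal_M by (intro ideal_prod_mono ideal_pow_ideal) auto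
    then show False using Suc(4) by blast
  qed
  then have "has_OA_factorization R J" using Suc(1) J by blast
  moreover have "OA_ideal (PIdl x) R"
  proof (rule OA_ideal_if_MM_subset)
    show "proper_ideal (PIdl x) R"
      using x by (intro proper_cgenideal) (auto simp: M_eq)
    show "M \<cdot> M \<subseteq> PIdl x"
      unfolding MM using ideal_prod_inter[OF X ideal_M] by blast
  qed
  ultimately show ?case
    unfolding J(3) by (intro has_OA_factorization_Cons)
qed

text \<open>By \<open>Int\<close> every nonzero proper ideal has an exact \<open>M\<close>-adic
  order; the zero ideal has none, so it is treated by \<open>zero\<close>.\<close>

lemma divided_imp_OAF_ring:
  assumes div: "divided_ideal (M \<cdot> M) R" and Int: "(\<Inter>n\<in>{1..}. ipow M n) = {\<zero>}"
    and zero: "has_OA_factorization R {\<zero>}"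
  shows "OAF_ring R"
  unfolding OAF_ring_def
proof (intro allI impI)
  fix I assume I: "proper_ideal I R"
  then have id: "ideal I R" by (simp add: proper_ideal_def)
  show "has_OA_factorization R I"
  proof (cases "I = {\<zero>}")
    case False
    then have nz: "\<not> I \<subseteq> {\<zero>}" using ideal_zero_closed[OF id] by blast
    have I1: "I \<subseteq> ipow M (Suc 0)"
      using proper_ideal_subset_M[OF I] ideal_pow_1[OF ideal_M] by simp
    obtain k where k: "k \<ge> 1" "\<not> I \<subseteq> ipow M k"
      using nz unfolding Int[symmetric] by auto
    have "\<exists>n. I \<subseteq> ipow M (Suc n) \<and> \<not> I \<subseteq> ipow M (Suc (Suc n))"
    proof (rule ccontr)
      assume "\<not> ?thesis"
      then have "I \<subseteq> ipow M (Suc n)" for n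
        using I1 by (induct n) auto
      then show False using k by (metis Suc_le_D One_nat_def)
    qed
    then obtain n where n: "I \<subseteq> ipow M (Suc n)" "\<not> I \<subseteq> ipow M (Suc (Suc n))" by blast
    \<comment> \<open>Were \<open>M\<close> idempotent, its powers would be constant and
      \<open>I\<close> could not separate two of them.\<close>
    have "\<not> M \<subseteq> M \<cdot> M"
    proof
      assume "M \<subseteq> M \<cdot> M"
      then have "M \<cdot> M = M" using MM_subset by blast
      then have "ipow M (Suc (Suc n)) = ipow M (Suc n)"
        using ideal_M by (simp only: ideal_pow_Suc ideal_prod_assoc ideal_pow_ideal)
      then show False using n by simp
    qed
    then obtain x where "x \<in> M" "x \<notin> M \<cdot> M" by blast
    then show ?thesis using divided_OA_factorization[OF div _ _ id n] by blast
  qed (use zero in simp)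
qed

section \<open>Principal ideals generated outside \<open>M \<cdot> M\<close>\<close>

text \<open>Suppose \<open>PIdl p\<close> does not contain \<open>M \<cdot> M\<close>, so it is prime. As \<open>M \<cdot> p \<subseteq> PIdl (a \<otimes> p)\<close>, the ideal \<open>M\<close> is
  \<open>PIdl a\<close> plus the annihilator of \<open>p\<close>, which yields \<open>z \<notin> PIdl a\<close> with \<open>p \<otimes> z = \<zero>\<close>. The elements
  \<open>q = p + a^3\<close> and \<open>q' = p + a^4\<close> again generate primes, and both generate \<open>PIdl z\<close>. So \<open>a^3 - a^4\<close>,
  and with it \<open>a\<close>, lies in \<open>PIdl q'\<close>, which is impossible.\<close>

lemma principal_dichotomy:
  assumes H: "\<And>a. a \<in> M \<Longrightarrow> a \<notin> M \<cdot> M \<Longrightarrow> primeideal (PIdl a) R \<or> M \<cdot> M \<subseteq> PIdl a"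
    and a: "a \<in> M" "a \<notin> M \<cdot> M" "\<not> primeideal (PIdl a) R"
    and p: "p \<in> M" "p \<notin> M \<cdot> M"
  shows "M \<cdot> M \<subseteq> PIdl p"
proof (rule ccontr)
  assume np: "\<not> M \<cdot> M \<subseteq> PIdl p"
  have ac: "a \<in> carrier R" and pc: "p \<in> carrier R" using a p M_carrier by auto
  have Ia: "ideal (PIdl a) R" and Ip: "ideal (PIdl p) R"
    using ac pc cgenideal_ideal by auto
  have aM: "M \<cdot> M \<subseteq> PIdl a" using H a by blast
  have pp: "primeideal (PIdl p) R" using H p np by blast
  have a_notin: "a \<notin> PIdl q" if "q \<in> carrier R" "\<not> M \<cdot> M \<subseteq> PIdl q" for q
    using that aM cgenideal_subset_iff[OF cgenideal_ideal[OF that(1)] ac] by blast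
  have "PIdl a \<noteq> M" using a(3) primeideal_M by metis
  moreover have "PIdl a \<subseteq> M" using a(1) cgenideal_subset_iff[OF ideal_M ac] by blast
  ultimately obtain m where m: "m \<in> M" "m \<notin> PIdl a" by blast
  have mc: "m \<in> carrier R" using m M_carrier by blast
  have "p \<otimes> m \<in> PIdl a" using mult_MM[OF p(1) m(1)] aM by blast
  then obtain m1 where m1: "m1 \<in> carrier R" "p \<otimes> m = m1 \<otimes> a"
    by (auto simp: mem_cgenideal_iff)
  have "m1 \<otimes> a \<in> PIdl p"
    using m1(2) mc pc by (metis m_comm mem_cgenideal_iff)
  then have "m1 \<in> PIdl p"
    using primeideal.I_prime[OF pp m1(1) ac] a_notin[OF pc np] by blast
  then obtain r where r: "r \<in> carrier R" "m1 = r \<otimes> p" by (auto simp: mem_cgenideal_iff)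
  \<comment> \<open>Since \<open>p \<otimes> m = r \<otimes> p \<otimes> a\<close>, subtracting
    \<open>r \<otimes> a\<close> from \<open>m\<close> yields an annihilator of \<open>p\<close> in
    the same class modulo \<open>PIdl a\<close>.\<close>
  define z where "z = m \<ominus> r \<otimes> a"
  have zc: "z \<in> carrier R" using mc r ac by (simp add: z_def)
  have "p \<otimes> z = p \<otimes> m \<ominus> r \<otimes> p \<otimes> a"
    unfolding z_def using pc mc r(1) ac by algebra
  also have "\<dots> = \<zero>"
    unfolding m1(2) r(2) using r(1) pc ac by algebra
  finally have pz: "p \<otimes> z = \<zero>" .
  have ra: "r \<otimes> a \<in> PIdl a" using r by (auto simp: mem_cgenideal_iff)
  have z_a: "z \<notin> PIdl a"
  proof
    assume "z \<in> PIdl a"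
    then have "z \<oplus> r \<otimes> a \<in> PIdl a" using ideal_add_closed[OF Ia] ra by blast
    moreover have "z \<oplus> r \<otimes> a = m" unfolding z_def using mc r ac by algebra
    ultimately show False using m by simp
  qed
  have zM: "z \<in> M" "z \<notin> M \<cdot> M"
    using ideal_diff_closed[OF ideal_M m(1)] ra \<open>PIdl a \<subseteq> M\<close> z_a aM by (auto simp: z_def)
  \<comment> \<open>\<open>b\<close> lies in \<open>M \<cdot> M\<close> but not in
    \<open>PIdl p\<close>. So \<open>p \<oplus> b \<otimes> s\<close> stays outside
    \<open>M \<cdot> M\<close>; taking \<open>s = a\<close> and \<open>s = b\<close> gives
    \<open>q\<close> and \<open>q'\<close>.\<close>
  define b where "b = a \<otimes> a"
  have bc: "b \<in> carrier R" and bMM: "b \<in> M \<cdot> M"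
    using ac mult_MM[OF a(1) a(1)] by (auto simp: b_def)
  have ab_p: "a \<otimes> t \<in> PIdl p \<Longrightarrow> t \<in> PIdl p" if "t \<in> carrier R" for t
    using primeideal.I_prime[OF pp ac that] a_notin[OF pc np] by blast
  have b_p: "b \<notin> PIdl p"
    using ab_p[of a] ac a_notin[OF pc np] by (auto simp: b_def)
  have cancel: "t \<in> I" if "ideal I R" "t \<in> carrier R" "s \<in> M" "t \<otimes> (\<one> \<ominus> s) \<in> I" for I t s
    using ideal_cancel_unit[OF that(1,2) one_minus_Units[OF that(3)] that(4)] .
  have key: "primeideal (PIdl (p \<oplus> b \<otimes> s)) R \<and> a \<notin> PIdl (p \<oplus> b \<otimes> s)
      \<and> p \<oplus> b \<otimes> s \<in> PIdl z \<and> z \<in> PIdl (p \<oplus> b \<otimes> s)"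
    if s: "s \<in> M" "b \<otimes> s \<notin> PIdl p" for s
  proof -
    define q where "q = p \<oplus> b \<otimes> s"
    have sc: "s \<in> carrier R" using s M_carrier by blast
    have qc: "q \<in> carrier R" using sc pc bc by (simp add: q_def)
    have Iq: "ideal (PIdl q) R" using cgenideal_ideal[OF qc] .
    have bs: "b \<otimes> s \<in> M \<cdot> M" using ideal.I_r_closed[OF ideal_MM bMM sc] .
    have qM: "q \<in> M"
      using ideal_add_closed[OF ideal_M p(1)] bs MM_subset by (auto simp: q_def)
    have qMM: "q \<notin> M \<cdot> M"
    proof
      assume "q \<in> M \<cdot> M"
      then have "q \<ominus> b \<otimes> s \<in> M \<cdot> M" using ideal_diff_closed[OF ideal_MM] bs by blast
      moreover have "q \<ominus> b \<otimes> s = p" unfolding q_def using pc bc sc by algebra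
      ultimately show False using p by simp
    qed
    \<comment> \<open>If \<open>b = t \<otimes> q\<close>, then
      \<open>b \<otimes> (\<one> \<ominus> t \<otimes> s) = t \<otimes> p\<close>, and cancelling
      the unit puts \<open>b\<close> into \<open>PIdl p\<close>.\<close>
    have nq: "\<not> M \<cdot> M \<subseteq> PIdl q"
    proof
      assume "M \<cdot> M \<subseteq> PIdl q"
      then obtain t where t: "t \<in> carrier R" "b = t \<otimes> q"
        using bMM mem_cgenideal_iff by blast
      have "b \<otimes> (\<one> \<ominus> t \<otimes> s) = b \<ominus> t \<otimes> (b \<otimes> s)"
        using bc t(1) sc by algebra
      also have "\<dots> = t \<otimes> (p \<oplus> b \<otimes> s) \<ominus> t \<otimes> (b \<otimes> s)"
        using t(2) by (simp add: q_def)
      also have "\<dots> = t \<otimes> p"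
        using t(1) pc bc sc by algebra
      finally have "b \<otimes> (\<one> \<ominus> t \<otimes> s) \<in> PIdl p"
        using t(1) by (auto simp: mem_cgenideal_iff)
      then show False
        using cancel[OF Ip bc ideal.I_l_closed[OF ideal_M s(1) t(1)]] b_p by blast
    qed
    have pq: "primeideal (PIdl q) R" using H[OF qM qMM] nq by blast
    have p_q: "p \<notin> PIdl q"
    proof
      assume "p \<in> PIdl q"
      then obtain t where t: "t \<in> carrier R" "p = t \<otimes> q" by (auto simp: mem_cgenideal_iff)
      have "t \<notin> M" using t p(2) qM mult_MM by blast
      then have u: "t \<in> Units R" using t by (simp add: Units_iff)
      then have "q = inv t \<otimes> p" using t qc by (simp add: m_assoc[symmetric])
      then have "q \<in> PIdl p" using u by (auto simp: mem_cgenideal_iff)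
      then have "q \<ominus> p \<in> PIdl p" using ideal_diff_closed[OF Ip] cgenideal_self[OF pc] by blast
      moreover have "q \<ominus> p = b \<otimes> s" unfolding q_def using pc bc sc by algebra
      ultimately show False using s by simp
    qed
    \<comment> \<open>The prime \<open>PIdl q\<close> contains
      \<open>p \<otimes> z = \<zero>\<close> but not \<open>p\<close>. As
      \<open>z \<notin> M \<cdot> M\<close>, its cofactor is a unit, so \<open>q\<close> and
      \<open>z\<close> are associates.\<close>
    have z_q: "z \<in> PIdl q"
      using primeideal.I_prime[OF pq pc zc] pz p_q ideal_zero_closed[OF Iq] by simp
    then obtain t where t: "t \<in> carrier R" "z = t \<otimes> q" by (auto simp: mem_cgenideal_iff)
    have "t \<notin> M" using t zM qM mult_MM by blast
    then have u: "t \<in> Units R" using t by (simp add: Units_iff)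
    then have "q = inv t \<otimes> z" using t qc by (simp add: m_assoc[symmetric])
    then have "q \<in> PIdl z" using u by (auto simp: mem_cgenideal_iff)
    then show ?thesis
      using pq a_notin[OF qc nq] z_q by (simp add: q_def)
  qed
  have bM: "b \<in> M" using bMM MM_subset by blast
  have ba: "b \<otimes> a \<notin> PIdl p" using ab_p[OF bc] b_p bc ac by (auto simp: m_comm)
  have bb: "b \<otimes> b \<notin> PIdl p"
    using primeideal.I_prime[OF pp bc bc] b_p by blast
  define q where "q = p \<oplus> b \<otimes> a"
  define q' where "q' = p \<oplus> b \<otimes> b"
  have qc: "q \<in> carrier R" "q' \<in> carrier R" using pc bc ac by (auto simp: q_def q'_def)
  have Iq': "ideal (PIdl q') R" using qc cgenideal_ideal by blast
  have "PIdl z \<subseteq> PIdl q'"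
    using key[OF bM bb] cgenideal_subset_iff[OF Iq' zc] by (simp add: q'_def)
  then have "q \<in> PIdl q'" using key[OF a(1) ba] by (auto simp: q_def)
  then have "q \<ominus> q' \<in> PIdl q'"
    using ideal_diff_closed[OF Iq'] cgenideal_self[OF qc(2)] by blast
  moreover have "q \<ominus> q' = (b \<otimes> a) \<otimes> (\<one> \<ominus> a)"
    unfolding q_def q'_def b_def using pc ac by algebra
  ultimately have "b \<otimes> a \<in> PIdl q'" using cancel[OF Iq' _ a(1)] bc ac by simp
  moreover have "primeideal (PIdl q') R" "a \<notin> PIdl q'"
    using key[OF bM bb] by (auto simp: q'_def)
  ultimately show False
    using primeideal.I_prime[of "PIdl q'" R] ac bc by (metis b_def)
qed

text \<open>If a product is principal, a factor that is not contained in \<open>M \<cdot> M\<close> can be replaced by one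
  of its elements: these generate the factor, so by Nakayama one of them does not push the product
  into \<open>(PIdl y) \<cdot> M\<close>.\<close>

lemma cgenideal_eq_prod_replace:
  assumes y: "y \<in> carrier R" and J: "ideal J R" "J \<subseteq> M" "\<not> J \<subseteq> M \<cdot> M"
    and L: "ideal L R" and eq: "PIdl y = J \<cdot> L"
  obtains a where "a \<in> J" "a \<notin> M \<cdot> M" "PIdl y = (PIdl a) \<cdot> L"
proof -
  have Iy: "ideal (PIdl y) R" using cgenideal_ideal[OF y] .
  have Jc: "x \<in> carrier R" if "x \<in> J" for x using ideal.Icarr[OF J(1) that] .
  have Lc: "x \<in> carrier R" if "x \<in> L" for x using ideal.Icarr[OF L that] .
  have sub: "(PIdl a) \<cdot> L \<subseteq> PIdl y" if "a \<in> J" for a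
    unfolding eq using that cgenideal_subset_iff[OF J(1) Jc[OF that]] J(1) L
    by (intro ideal_prod_mono) auto
  have id: "ideal ((PIdl a) \<cdot> L) R" if "a \<in> J" for a
    using that Jc cgenideal_ideal L ideal_prod_is_ideal by simp
  have "\<exists>a\<in>J. a \<notin> M \<cdot> M \<and> y \<in> (PIdl a) \<cdot> L"
  proof (rule ccontr)
    assume H: "\<not> ?thesis"
    have K: "ideal ((PIdl y) \<cdot> M) R" using ideal_prod_is_ideal[OF Iy ideal_M] .
    \<comment> \<open>Write \<open>a \<otimes> l = r \<otimes> y\<close>: a unit \<open>r\<close>
      would put \<open>y\<close> into \<open>(PIdl a) \<cdot> L\<close>, against
      \<open>H\<close>.\<close>
    have gen: "a \<otimes> l \<in> (PIdl y) \<cdot> M" if a: "a \<in> J" "a \<notin> M \<cdot> M" and l: "l \<in> L" for a l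
    proof -
      have al: "a \<otimes> l \<in> (PIdl a) \<cdot> L"
        using mem_cgenideal_prod_iff[OF L Jc[OF a(1)]] l by blast
      then obtain r where r: "r \<in> carrier R" "a \<otimes> l = r \<otimes> y"
        using subsetD[OF sub[OF a(1)]] by (auto simp: mem_cgenideal_iff)
      have "r \<in> M"
      proof (rule ccontr)
        assume "r \<notin> M"
        then have "r \<in> Units R" using r by (simp add: Units_iff)
        then have "y \<in> (PIdl a) \<cdot> L"
          using ideal_cancel_unit[OF id[OF a(1)] y] al r y by (simp add: m_comm)
        then show False using H a by blast
      qed
      then show ?thesis
        using mult_mem_cgenideal_prod[OF ideal_M y] r by simp
    qed
    obtain a where a: "a \<in> J" "a \<notin> M \<cdot> M" using J(3) by blast
    have "j \<otimes> l \<in> (PIdl y) \<cdot> M" if j: "j \<in> J" and l: "l \<in> L" for j l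
    proof (cases "j \<in> M \<cdot> M")
      \<comment> \<open>Here \<open>j = (j \<oplus> a) \<ominus> a\<close> is a difference of two
        elements of \<open>J\<close> outside \<open>M \<cdot> M\<close>, to which \<open>gen\<close>
        applies.\<close>
      case True
      have "(j \<oplus> a) \<ominus> j = a" using Jc[OF j] Jc[OF a(1)] by algebra
      then have "j \<oplus> a \<notin> M \<cdot> M"
        using ideal_diff_closed[OF ideal_MM _ True] a(2) by metis
      then have "(j \<oplus> a) \<otimes> l \<ominus> a \<otimes> l \<in> (PIdl y) \<cdot> M"
        using ideal_add_closed[OF J(1) j a(1)] gen a l by (intro ideal_diff_closed[OF K]) auto
      moreover have "(j \<oplus> a) \<otimes> l \<ominus> a \<otimes> l = j \<otimes> l"
        using Jc[OF j] Jc[OF a(1)] Lc[OF l] by algebra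
      ultimately show ?thesis by simp
    qed (use gen j l in blast)
    then have "PIdl y \<subseteq> (PIdl y) \<cdot> M"
      by (subst eq) (rule ideal_prod_subsetI[OF K])
    then have "y = \<zero>"
      using eq_zero_if_mem_cgenideal_prod_M[OF y] cgenideal_self[OF y] by blast
    \<comment> \<open>Even \<open>y = \<zero>\<close> contradicts \<open>H\<close>, because
      \<open>\<zero>\<close> lies in \<open>(PIdl a) \<cdot> L\<close>.\<close>
    then show False
      using H a ideal_zero_closed[OF id[OF a(1)]] by blast
  qed
  then obtain a where a: "a \<in> J" "a \<notin> M \<cdot> M" "y \<in> (PIdl a) \<cdot> L" by blast
  then have "PIdl y = (PIdl a) \<cdot> L"
    using sub[OF a(1)] cgenideal_subset_iff[OF id[OF a(1)] y] by blast
  then show thesis using that a by blast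
qed

section \<open>Passing from OA-factors to prime factors\<close>

lemma OA_ideal_subset_M: "OA_ideal J R \<Longrightarrow> J \<subseteq> M"
  using proper_ideal_subset_M by (simp add: OA_ideal_def)

lemma OA_ideal_imp_ideal: "OA_ideal J R \<Longrightarrow> ideal J R"
  by (simp add: OA_ideal_def proper_ideal_def)

text \<open>The ideal \<open>K\<close> collects the factors that have already been replaced by primes.\<close>

lemma replace_OA_by_prime_factors:
  assumes prime: "\<And>a. a \<in> M \<Longrightarrow> a \<notin> M \<cdot> M \<Longrightarrow> primeideal (PIdl a) R"
    and y: "y \<in> carrier R"
    and "\<forall>J\<in>set Js. OA_ideal J R" "ideal K R" "PIdl y = K \<cdot> ideal_list_prod R Js"
  shows "\<exists>Ps. (\<forall>P\<in>set Ps. primeideal P R) \<and> length Js \<le> length Ps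
    \<and> PIdl y = K \<cdot> ideal_list_prod R Ps"
  using assms(3-)
proof (induct Js arbitrary: K)
  case Nil
  then show ?case by (intro exI[of _ "[]"]) simp
next
  case (Cons J Js)
  define L where "L = ideal_list_prod R Js"
  have J: "OA_ideal J R" "ideal J R" using Cons OA_ideal_imp_ideal by auto
  have L: "ideal L R"
    unfolding L_def using Cons OA_ideal_imp_ideal by (intro ideal_list_prod_ideal) auto
  have eq: "PIdl y = K \<cdot> (J \<cdot> L)"
    using Cons by (simp add: ideal_list_prod_Cons L_def)
  \<comment> \<open>Once the head is a prime \<open>P\<close>, it moves into \<open>K\<close> and
    the induction hypothesis treats the tail.\<close>
  have step: ?case if "primeideal P R" "PIdl y = K \<cdot> (P \<cdot> L)" for P
  proof -
    have P: "ideal P R" using primeideal.axioms(1)[OF that(1)] .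
    have "PIdl y = (K \<cdot> P) \<cdot> ideal_list_prod R Js"
      using that(2) ideal_prod_assoc[OF Cons(3) P L] by (simp add: L_def)
    then obtain Ps where Ps: "\<forall>P\<in>set Ps. primeideal P R" "length Js \<le> length Ps"
        "PIdl y = (K \<cdot> P) \<cdot> ideal_list_prod R Ps"
      using Cons(1)[of "K \<cdot> P"] Cons(2) ideal_prod_is_ideal[OF Cons(3) P] by auto
    have "ideal (ideal_list_prod R Ps) R"
      using Ps(1) primeideal.axioms(1) by (intro ideal_list_prod_ideal) blast
    then have "PIdl y = K \<cdot> ideal_list_prod R (P # Ps)"
      using Ps(3) ideal_prod_assoc[OF Cons(3) P] by (simp add: ideal_list_prod_Cons)
    then show ?thesis
      using Ps that(1) by (intro exI[of _ "P # Ps"]) simp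
  qed
  consider "primeideal J R" | "J = M \<cdot> M" | "M \<cdot> M \<subseteq> J" "\<not> J \<subseteq> M \<cdot> M"
    using OA_ideal_cases[OF J(1)] by blast
  then show ?case
  proof cases
    case 1
    then show ?thesis using step eq by blast
  next
    \<comment> \<open>This factor has no element outside \<open>M \<cdot> M\<close>; it is split
      into two copies of the prime \<open>M\<close>, so the list grows.\<close>
    case 2
    have KM: "ideal (K \<cdot> M) R" using ideal_prod_is_ideal[OF Cons(3) ideal_M] .
    have KMM: "ideal ((K \<cdot> M) \<cdot> M) R" using ideal_prod_is_ideal[OF KM ideal_M] .
    have *: "((K \<cdot> M) \<cdot> M) \<cdot> N = K \<cdot> (M \<cdot> (M \<cdot> N))" if "ideal N R" for N
      using that Cons(3) ideal_M KM by (simp add: ideal_prod_assoc ideal_prod_is_ideal)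
    have "PIdl y = ((K \<cdot> M) \<cdot> M) \<cdot> ideal_list_prod R Js"
      unfolding eq 2 L_def[symmetric] *[OF L] using ideal_M L by (simp add: ideal_prod_assoc)
    then obtain Ps where Ps: "\<forall>P\<in>set Ps. primeideal P R" "length Js \<le> length Ps"
        "PIdl y = ((K \<cdot> M) \<cdot> M) \<cdot> ideal_list_prod R Ps"
      using Cons(1)[OF _ KMM] Cons(2) by auto
    have "ideal (ideal_list_prod R Ps) R"
      using Ps(1) primeideal.axioms(1) by (intro ideal_list_prod_ideal) blast
    then have "PIdl y = K \<cdot> ideal_list_prod R (M # M # Ps)"
      using Ps(3) * by (simp add: ideal_list_prod_Cons)
    then show ?thesis
      using Ps primeideal_M by (intro exI[of _ "M # M # Ps"]) simp
  next
    case 3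
    \<comment> \<open>All factors other than \<open>J\<close> are gathered into the cofactor
      \<open>K \<cdot> L\<close> of the replacement lemma.\<close>
    have KL: "ideal (K \<cdot> L) R" using ideal_prod_is_ideal[OF Cons(3) L] .
    have swap: "N \<cdot> (K \<cdot> L) = K \<cdot> (N \<cdot> L)" if "ideal N R" for N
      using that Cons(3) L by (metis ideal_prod_assoc ideal_prod_commute)
    have "PIdl y = J \<cdot> (K \<cdot> L)" using eq swap J by simp
    then obtain a where a: "a \<in> J" "a \<notin> M \<cdot> M" "PIdl y = (PIdl a) \<cdot> (K \<cdot> L)"
      using cgenideal_eq_prod_replace[OF y J(2) OA_ideal_subset_M[OF J(1)] 3(2) KL] by blast
    have aM: "a \<in> M" using a(1) OA_ideal_subset_M[OF J(1)] by blast
    have "ideal (PIdl a) R" using aM M_carrier cgenideal_ideal by blast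
    then show ?thesis
      using step[OF prime[OF aM a(2)]] a(3) swap by simp
  qed
qed

lemma pi_ring_if_all_prime:
  assumes fact: "\<And>I. proper_ideal I R \<Longrightarrow> principalideal I R \<Longrightarrow> has_OA_factorization R I"
    and prime: "\<And>a. a \<in> M \<Longrightarrow> a \<notin> M \<cdot> M \<Longrightarrow> primeideal (PIdl a) R"
  shows "pi_ring R"
  unfolding pi_ring_def
proof (intro allI impI)
  fix I assume I: "proper_ideal I R \<and> principalideal I R"
  then obtain y where y: "y \<in> carrier R" "I = PIdl y" by (auto simp: principalideal_iff)
  obtain Js where Js: "Js \<noteq> []" "\<forall>J\<in>set Js. OA_ideal J R" "I = ideal_list_prod R Js"
    using fact I by (auto simp: has_OA_factorization_def)
  have "PIdl y = carrier R \<cdot> ideal_list_prod R Js"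
    using Js y I ideal_prod_one_left by (simp add: proper_ideal_def)
  then obtain Ps where Ps: "\<forall>P\<in>set Ps. primeideal P R" "length Js \<le> length Ps"
      "PIdl y = carrier R \<cdot> ideal_list_prod R Ps"
    using replace_OA_by_prime_factors[OF prime y(1) Js(2) oneideal] by auto
  have "ideal (ideal_list_prod R Ps) R"
    using Ps(1) primeideal.axioms(1) by (intro ideal_list_prod_ideal) blast
  then have "I = ideal_list_prod R Ps"
    using Ps y ideal_prod_one_left by simp
  \<comment> \<open>The length bound of \<open>replace_OA_by_prime_factors\<close> secures a
    nonempty factorization.\<close>
  moreover have "Ps \<noteq> []" using Js(1) Ps(2) by auto
  ultimately show "has_prime_factorization R I"
    unfolding has_prime_factorization_def using Ps(1) by blast
qed

section \<open>Divided \<open>M \<cdot> M\<close> and the powers of \<open>M\<close>\<close>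

text \<open>A product of two or more OA-ideals lies in \<open>M \<cdot> M\<close>, so
  \<open>PIdl a\<close> has a single factor and is itself an OA-ideal.\<close>

lemma cgenideal_prime_or_MM_subset:
  assumes fact: "\<And>I. proper_ideal I R \<Longrightarrow> principalideal I R \<Longrightarrow> has_OA_factorization R I"
    and a: "a \<in> M" "a \<notin> M \<cdot> M"
  shows "primeideal (PIdl a) R \<or> M \<cdot> M \<subseteq> PIdl a"
proof -
  have ac: "a \<in> carrier R" using a M_carrier by blast
  have "proper_ideal (PIdl a) R" using a by (intro proper_cgenideal) (auto simp: M_eq)
  then obtain Js where Js: "Js \<noteq> []" "\<forall>J\<in>set Js. OA_ideal J R" "PIdl a = ideal_list_prod R Js"
    using fact[OF _ cgenideal_is_principalideal[OF ac]] by (auto simp: has_OA_factorization_def)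
  then obtain J Js' where Js': "Js = J # Js'" by (cases Js) auto
  have J: "OA_ideal J R" "ideal J R" using Js Js' OA_ideal_imp_ideal by auto
  have "Js' = []"
  proof (rule ccontr)
    assume "Js' \<noteq> []"
    then obtain J' where J': "J' \<in> set Js'" by (cases Js') auto
    have "ideal_list_prod R Js' \<subseteq> J'"
      using Js(2) Js' J' OA_ideal_imp_ideal by (intro ideal_list_prod_subset) auto
    also have "J' \<subseteq> M" using Js(2) Js' J' OA_ideal_subset_M by auto
    finally have "J \<cdot> ideal_list_prod R Js' \<subseteq> M \<cdot> M"
      using OA_ideal_subset_M[OF J(1)] ideal_M by (intro ideal_prod_mono) auto
    then show False
      using a(2) cgenideal_self[OF ac] Js(3) by (auto simp: Js' ideal_list_prod_Cons)
  qed
  then have "PIdl a = J" using Js(3) J(2) Js' by (simp add: ideal_list_prod_single)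
  then show ?thesis using OA_ideal_cases[OF J(1)] by simp
qed

text \<open>This bounds from below those factorizations in which every factor contains
  \<open>M \<cdot> M\<close>.\<close>

lemma ipow_subset_ideal_list_prod:
  assumes "\<forall>J\<in>set Js. ideal J R \<and> M \<cdot> M \<subseteq> J"
  shows "ipow M (2 * length Js) \<subseteq> ideal_list_prod R Js"
  using assms
proof (induct Js)
  case Nil
  then show ?case by (simp add: ideal_list_prod_Nil ideals_set_def)
next
  case (Cons J Js)
  have "ipow M 2 \<cdot> ipow M (2 * length Js) \<subseteq> J \<cdot> ideal_list_prod R Js"
    using Cons ideal_pow_2[OF ideal_M] by (intro ideal_prod_mono ideal_list_prod_ideal) auto
  then show ?case
    by (simp only: ideal_pow_add[OF ideal_M] ideal_list_prod_Cons) simp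
qed

lemma divided_if_all_MM_subset:
  assumes "\<And>a. a \<in> M \<Longrightarrow> a \<notin> M \<cdot> M \<Longrightarrow> M \<cdot> M \<subseteq> PIdl a"
  shows "divided_ideal (M \<cdot> M) R"
  unfolding divided_ideal_def
proof (intro conjI allI impI ideal_MM)
  fix J assume J: "ideal J R"
  show "M \<cdot> M \<subseteq> J \<or> J \<subseteq> M \<cdot> M"
  proof (cases "proper_ideal J R")
    case True
    have "M \<cdot> M \<subseteq> J" if "a \<in> J" "a \<notin> M \<cdot> M" for a
    proof -
      have "a \<in> M" using proper_ideal_subset_M[OF True] that by blast
      then show ?thesis
        using assms that M_carrier cgenideal_subset_iff[OF J] by blast
    qed
    then show ?thesis by blast
  next
    case False
    then have "J = carrier R" using J by (simp add: proper_ideal_def)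
    then show ?thesis using ideal_subset_carrier[OF ideal_MM] by blast
  qed
qed

text \<open>A nonmaximal prime \<open>P\<close> lies in \<open>PIdl x\<close> without containing \<open>x\<close>, so \<open>P \<subseteq> (PIdl x) \<cdot> P\<close>.\<close>

lemma nonmaximal_prime_subset_prod_M:
  assumes div: "divided_ideal (M \<cdot> M) R" and x: "x \<in> M" "x \<notin> M \<cdot> M"
    and P: "primeideal P R" "\<not> M \<cdot> M \<subseteq> P"
  shows "P \<subseteq> M \<cdot> P"
proof
  have xc: "x \<in> carrier R" using x M_carrier by blast
  have IP: "ideal P R" using primeideal.axioms(1)[OF P(1)] .
  have X: "M \<cdot> M \<subseteq> PIdl x"
    using div x cgenideal_ideal[OF xc] cgenideal_self[OF xc] unfolding divided_ideal_def by blast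
  \<comment> \<open>\<open>P\<close> cannot contain \<open>x\<close>, as \<open>PIdl x\<close>
    contains \<open>M \<cdot> M\<close>. By dividedness \<open>P\<close> lies in
    \<open>M \<cdot> M\<close>, hence in \<open>PIdl x\<close>.\<close>
  have "x \<notin> P" using X P(2) cgenideal_subset_iff[OF IP xc] by blast
  have "P \<subseteq> PIdl x" using div IP P(2) X unfolding divided_ideal_def by blast
  fix p assume p: "p \<in> P"
  then obtain r where r: "r \<in> carrier R" "p = r \<otimes> x"
    using subsetD[OF \<open>P \<subseteq> PIdl x\<close> p] by (auto simp: mem_cgenideal_iff)
  have "r \<in> P"
    using primeideal.I_prime[OF P(1) r(1) xc] p r(2) \<open>x \<notin> P\<close> by blast
  then have "x \<otimes> r \<in> M \<cdot> P" using x by (intro ideal_prod.prod)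
  then show "p \<in> M \<cdot> P" using r xc by (simp add: m_comm)
qed

text \<open>Iterates \<open>P \<subseteq> M \<cdot> P\<close>. The condition on
  \<open>M \<cdot> M\<close> encodes nonmaximality: a prime containing \<open>M \<cdot> M\<close>
  equals \<open>M\<close>.\<close>

lemma nonmaximal_prime_subset_ipow:
  assumes "divided_ideal (M \<cdot> M) R" "x \<in> M" "x \<notin> M \<cdot> M" "primeideal P R" "\<not> M \<cdot> M \<subseteq> P"
  shows "P \<subseteq> ipow M n"
proof (induct n)
  case 0
  then show ?case
    using ideal_subset_carrier[OF primeideal.axioms(1)[OF assms(4)]]
    by (simp only: ideal_pow_0)
next
  case (Suc n)
  have "P \<subseteq> M \<cdot> P" using nonmaximal_prime_subset_prod_M[OF assms] .
  also have "\<dots> \<subseteq> M \<cdot> ipow M n"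
    using Suc ideal_M ideal_pow_ideal by (intro ideal_prod_mono) auto
  also have "\<dots> = ipow M (Suc n)"
    unfolding ideal_pow_Suc using ideal_M ideal_pow_ideal by (intro ideal_prod_commute) auto
  finally show ?case .
qed

text \<open>The \<open>M\<close> gained by the one factor \<open>J\<close> can be moved to the
  front, which prepares for Nakayama.\<close>

lemma ideal_list_prod_subset_prod_M:
  assumes "\<And>K. K \<in> set Js \<Longrightarrow> ideal K R" "J \<in> set Js" "J \<subseteq> M \<cdot> J"
  shows "ideal_list_prod R Js \<subseteq> M \<cdot> ideal_list_prod R Js"
  using assms
proof (induct Js)
  case (Cons K Js)
  define L where "L = ideal_list_prod R Js"
  have L: "ideal L R" unfolding L_def using Cons(2) by (intro ideal_list_prod_ideal) simp
  have K: "ideal K R" using Cons(2) by simp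
  have MK_ML: "ideal (M \<cdot> L) R" "ideal (M \<cdot> K) R"
    using ideal_prod_is_ideal ideal_M K L by auto
  have "K \<cdot> L \<subseteq> M \<cdot> (K \<cdot> L)"
  proof (cases "J = K")
    case True
    then have "K \<cdot> L \<subseteq> (M \<cdot> K) \<cdot> L"
      using Cons(4) MK_ML L by (intro ideal_prod_mono) auto
    then show ?thesis using ideal_prod_assoc[OF ideal_M K L] by simp
  next
    case False
    then have "L \<subseteq> M \<cdot> L" using Cons unfolding L_def by simp
    then have "K \<cdot> L \<subseteq> K \<cdot> (M \<cdot> L)"
      using K MK_ML by (intro ideal_prod_mono) auto
    also have "\<dots> = M \<cdot> (K \<cdot> L)"
      using ideal_prod_assoc[OF ideal_M K L] ideal_prod_assoc[OF K ideal_M L]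
        ideal_prod_commute[OF K ideal_M] by simp
    finally show ?thesis .
  qed
  then show ?case by (simp add: ideal_list_prod_Cons L_def)
qed simp

lemma INT_ipow_eq_zero:
  assumes fact: "\<And>I. proper_ideal I R \<Longrightarrow> principalideal I R \<Longrightarrow> has_OA_factorization R I"
    and div: "divided_ideal (M \<cdot> M) R" and x: "x \<in> M" "x \<notin> M \<cdot> M"
  shows "(\<Inter>n\<in>{1..}. ipow M n) = {\<zero>}"
proof
  show "{\<zero>} \<subseteq> (\<Inter>n\<in>{1..}. ipow M n)"
    using ideal_zero_closed[OF ideal_pow_ideal[OF ideal_M]] by blast
  show "(\<Inter>n\<in>{1..}. ipow M n) \<subseteq> {\<zero>}"
  proof
    fix y assume "y \<in> (\<Inter>n\<in>{1..}. ipow M n)"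
    then have y: "y \<in> ipow M (Suc n)" for n by (rule INT_D) simp
    have yM: "y \<in> M" using y[of 0] ideal_pow_1[OF ideal_M] by simp
    have yc: "y \<in> carrier R" using yM M_carrier by blast
    have Iy: "ideal (PIdl y) R" using cgenideal_ideal[OF yc] .
    have "proper_ideal (PIdl y) R" using yM by (intro proper_cgenideal) (auto simp: M_eq)
    then obtain Js where Js: "Js \<noteq> []" "\<forall>J\<in>set Js. OA_ideal J R" "PIdl y = ideal_list_prod R Js"
      using fact[OF _ cgenideal_is_principalideal[OF yc]] by (auto simp: has_OA_factorization_def)
    have "y \<in> (PIdl y) \<cdot> M"
    proof (cases "\<forall>J\<in>set Js. M \<cdot> M \<subseteq> J")
      \<comment> \<open>Some power of \<open>M\<close> lies in \<open>PIdl y\<close>, and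
        \<open>y\<close> lies in the next power.\<close>
      case True
      then have "ipow M (2 * length Js) \<subseteq> PIdl y"
        unfolding Js(3) using Js(2) OA_ideal_imp_ideal by (intro ipow_subset_ideal_list_prod) blast
      then have "ipow M (2 * length Js) \<cdot> M \<subseteq> (PIdl y) \<cdot> M"
        using ideal_M Iy by (intro ideal_prod_mono) auto
      then show ?thesis using y[of "2 * length Js"] by (auto simp only: ideal_pow_Suc)
    next
      case False
      then obtain J where J: "J \<in> set Js" "\<not> M \<cdot> M \<subseteq> J" by blast
      then have P: "primeideal J R" using Js(2) OA_ideal_cases by blast
      have "ideal_list_prod R Js \<subseteq> M \<cdot> ideal_list_prod R Js"
        using Js(2) OA_ideal_imp_ideal J nonmaximal_prime_subset_prod_M[OF div x P]
        by (intro ideal_list_prod_subset_prod_M) auto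
      then have "y \<in> M \<cdot> (PIdl y)"
        using cgenideal_self[OF yc] Js(3) by auto
      then show ?thesis using ideal_prod_commute[OF ideal_M Iy] by simp
    qed
    then show "y \<in> {\<zero>}" using eq_zero_if_mem_cgenideal_prod_M[OF yc] by simp
  qed
qed

text \<open>If all factors of \<open>{\<zero>}\<close> contain \<open>M \<cdot> M\<close>, a power
  of \<open>M\<close> vanishes. Otherwise some factor is a prime inside every power of
  \<open>M\<close>, so \<open>{\<zero>}\<close> is prime.\<close>

lemma domain_or_nilpotent:
  assumes fact: "has_OA_factorization R {\<zero>}"
    and div: "divided_ideal (M \<cdot> M) R" and x: "x \<in> M" "x \<notin> M \<cdot> M"
    and Int: "(\<Inter>n\<in>{1..}. ipow M n) = {\<zero>}"
  shows "domain R \<or> nilpotent_ideal M R"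
proof -
  obtain Js where Js: "Js \<noteq> []" "\<forall>J\<in>set Js. OA_ideal J R" "{\<zero>} = ideal_list_prod R Js"
    using fact by (auto simp: has_OA_factorization_def)
  show ?thesis
  proof (cases "\<forall>J\<in>set Js. M \<cdot> M \<subseteq> J")
    case True
    then have "ipow M (2 * length Js) \<subseteq> {\<zero>}"
      unfolding Js(3) using Js(2) OA_ideal_imp_ideal by (intro ipow_subset_ideal_list_prod) blast
    then have "ipow M (2 * length Js) = {\<zero>}"
      using ideal_zero_closed[OF ideal_pow_ideal[OF ideal_M]] by blast
    moreover have "2 * length Js \<ge> 1" using Js(1) by (cases Js) auto
    ultimately show ?thesis
      unfolding nilpotent_ideal_def using ideal_M by blast
  next
    case False
    then obtain J where J: "J \<in> set Js" "\<not> M \<cdot> M \<subseteq> J" by blast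
    then have P: "primeideal J R" using Js(2) OA_ideal_cases by blast
    have "J \<subseteq> (\<Inter>n\<in>{1..}. ipow M n)"
      using nonmaximal_prime_subset_ipow[OF div x P J(2)] by blast
    then have "J = {\<zero>}"
      using Int ideal_zero_closed[OF primeideal.axioms(1)[OF P]] by blast
    then show ?thesis using zeroprimeideal_domainI P is_cring by blast
  qed
qed

lemma nilpotent_imp_INT_ipow_eq_zero:
  assumes "nilpotent_ideal M R"
  shows "(\<Inter>n\<in>{1..}. ipow M n) = {\<zero>}"
proof -
  obtain n where "n \<ge> 1" "ipow M n = {\<zero>}"
    using assms by (auto simp: nilpotent_ideal_def)
  then show ?thesis
    using ideal_zero_closed[OF ideal_pow_ideal[OF ideal_M]] by blast
qed

lemma nilpotent_imp_zero_has_OA_factorization: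
  assumes "nilpotent_ideal M R"
  shows "has_OA_factorization R {\<zero>}"
proof -
  obtain n where n: "n \<ge> 1" "ipow M n = {\<zero>}"
    using assms by (auto simp: nilpotent_ideal_def)
  have "has_OA_factorization R (ipow M (Suc k))" for k
  proof (induct k)
    case 0
    have "OA_ideal M R" using primeideal_imp_OA_ideal[OF primeideal_M] .
    then show ?case
      using OA_ideal_has_OA_factorization ideal_pow_1[OF ideal_M] by simp
  next
    case (Suc k)
    have "ipow M (Suc (Suc k)) = M \<cdot> ipow M (Suc k)"
      using ideal_prod_commute[OF ideal_pow_ideal[OF ideal_M] ideal_M]
      by (simp only: ideal_pow_Suc[of _ "Suc k"])
    then show ?case
      using has_OA_factorization_Cons[OF primeideal_imp_OA_ideal[OF primeideal_M] Suc] by simp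
  qed
  then show ?thesis using n by (metis One_nat_def Suc_le_D)
qed

lemma factorization_imp_pi_ring_or_divided:
  assumes fact: "\<And>I. proper_ideal I R \<Longrightarrow> principalideal I R \<Longrightarrow> has_OA_factorization R I"
    and not_pi: "\<not> pi_ring R"
  shows "divided_ideal (M \<cdot> M) R \<and> (\<Inter>n\<in>{1..}. ipow M n) = {\<zero>}
    \<and> (domain R \<or> nilpotent_ideal M R)"
proof -
  have "\<exists>a\<in>M. a \<notin> M \<cdot> M \<and> \<not> primeideal (PIdl a) R"
    using pi_ring_if_all_prime[OF fact] not_pi by blast
  \<comment> \<open>This \<open>a\<close> forces the same alternative on every other element outside
    \<open>M \<cdot> M\<close>, and also serves as the \<open>x\<close> of the later lemmas.\<close>
  then obtain a where a: "a \<in> M" "a \<notin> M \<cdot> M" "\<not> primeideal (PIdl a) R" by blast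
  have div: "divided_ideal (M \<cdot> M) R"
    by (intro divided_if_all_MM_subset principal_dichotomy[OF cgenideal_prime_or_MM_subset[OF fact] a])
  have "{\<zero>} = PIdl \<zero>"
    using cgenideal_subset_iff[OF zeroideal zero_closed] cgenideal_self[OF zero_closed] by auto
  then have "principalideal {\<zero>} R"
    using principalideal_iff zero_closed by blast
  moreover have "proper_ideal {\<zero>} R"
    using zeroideal ideal_zero_closed[OF ideal_M] one_notin_M by (auto simp: proper_ideal_iff)
  ultimately have zero: "has_OA_factorization R {\<zero>}" using fact by blast
  have Int: "(\<Inter>n\<in>{1..}. ipow M n) = {\<zero>}"
    using INT_ipow_eq_zero[OF fact div a(1,2)] .
  show ?thesis
    using div Int domain_or_nilpotent[OF zero div a(1,2) Int] by blast
qed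

end

section \<open>Locality in terms of nonunits, and the equivalence\<close>

text \<open>By Krull's theorem each nonunit lies in some maximal ideal; if there is only one, it
  consists of all nonunits.\<close>

lemma (in cring) local_ring_iff: "local_ring R \<longleftrightarrow> ideal (carrier R - Units R) R"
proof
  assume "local_ring R"
  then obtain N where N: "maximalideal N R" "\<And>N'. maximalideal N' R \<Longrightarrow> N' = N"
    unfolding local_ring_def by blast
  have id: "ideal N R" "carrier R \<noteq> N"
    using maximalideal.axioms(1)[OF N(1)] maximalideal.I_notcarr[OF N(1)] by auto
  have "x \<in> N" if x: "x \<in> carrier R" "x \<notin> Units R" for x
  proof -
    obtain N' where "maximalideal N' R" "PIdl x \<subseteq> N'"
      using proper_ideal_subset_maximalideal[OF proper_cgenideal[OF x]] .
    then show ?thesis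
      using N(2)[of N'] subsetD[OF _ cgenideal_self[OF x(1)]] by simp
  qed
  moreover have "x \<in> carrier R - Units R" if "x \<in> N" for x
  proof -
    have "proper_ideal N R" using id by (simp add: proper_ideal_def)
    then show ?thesis
      using proper_ideal_nonunit[of N x] ideal.Icarr[OF id(1) that] that by simp
  qed
  ultimately have "carrier R - Units R = N" by blast
  then show "ideal (carrier R - Units R) R" using id by simp
next
  assume "ideal (carrier R - Units R) R"
  then have "local_cring R (carrier R - Units R)"
    using is_cring by (simp add: local_cring_def local_cring_axioms_def)
  then show "local_ring R" by (rule local_cring.local_ring)
qed

theorem corollary4p3:
  fixes R (structure) and M
  assumes "cring R" and "\<one> \<noteq> \<zero>"
    and "M = jacobson_radical R"
  shows
    "((\<forall>I. proper_ideal I R \<and> principalideal I R \<longrightarrow> has_OA_factorization R I)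
        \<longleftrightarrow> pi_ring R \<or> OAF_ring R)
     \<and>
     (pi_ring R \<or> OAF_ring R
        \<longleftrightarrow> pi_ring R
          \<or> (local_ring R \<and> domain R \<and> divided_ideal (M [^]\<^bsub>ideals_set R\<^esub> (2::nat)) R
               \<and> (\<Inter>n \<in> {1::nat..}. M [^]\<^bsub>ideals_set R\<^esub> n) = {\<zero>})
          \<or> (local_ring R \<and> divided_ideal (M [^]\<^bsub>ideals_set R\<^esub> (2::nat)) R
               \<and> nilpotent_ideal M R))"
    (is "(?fact \<longleftrightarrow> ?pi \<or> ?oaf) \<and> (?pi \<or> ?oaf \<longleftrightarrow> ?pi \<or> ?B \<or> ?C)")
proof -
  interpret cring R by fact
  \<comment> \<open>Both equivalences follow from the cycle (2) to (1) to (3) to (2).\<close>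
  have imp21: "?fact" if "?pi \<or> ?oaf"
    using that
  proof
    assume ?pi
    then show ?fact by (simp add: pi_ring_def has_prime_factorization_imp_OA)
  next
    assume ?oaf
    then show ?fact by (simp add: OAF_ring_def)
  qed
  have local: "local_cring R M" if "local_ring R"
  proof -
    have loc: "local_cring R (carrier R - Units R)"
      using that is_cring by (simp add: local_ring_iff local_cring_def local_cring_axioms_def)
    then show ?thesis
      using assms(3) local_cring.jacobson_radical_eq[OF loc] by simp
  qed
  have imp13: "?pi \<or> ?B \<or> ?C" if fact: "?fact"
  proof (cases "local_ring R")
    case True
    then interpret local_cring R M by (rule local)
    show ?thesis
      using factorization_imp_pi_ring_or_divided fact True ideal_pow_2[OF ideal_M] by auto
  next
    \<comment> \<open>Without locality OA-ideals are prime, so the given factorizations are prime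
      factorizations.\<close>
    case False
    then have nl: "\<not> ideal (carrier R - Units R) R" using local_ring_iff by simp
    have "has_prime_factorization R I" if "has_OA_factorization R I" for I
      using that not_local_OA_ideal_imp_primeideal[OF nl assms(2)]
      unfolding has_OA_factorization_def has_prime_factorization_def by blast
    then have "?pi" using fact unfolding pi_ring_def by blast
    then show ?thesis by blast
  qed
  have imp32: "?pi \<or> ?oaf" if "?pi \<or> ?B \<or> ?C"
    using that
  proof (elim disjE)
    assume B: ?B
    then interpret local_cring R M using local by blast
    interpret domain R using B by blast
    \<comment> \<open>In a domain the zero ideal is prime and is its own factorization.\<close>
    have "has_OA_factorization R {\<zero>}"
      using OA_ideal_has_OA_factorization primeideal_imp_OA_ideal zeroprimeideal by blast
    then have ?oaf using B divided_imp_OAF_ring ideal_pow_2[OF ideal_M] by simp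
    then show ?thesis ..
  next
    assume C: ?C
    then interpret local_cring R M using local by blast
    have ?oaf
      using C divided_imp_OAF_ring ideal_pow_2[OF ideal_M] nilpotent_imp_INT_ipow_eq_zero
        nilpotent_imp_zero_has_OA_factorization by simp
    then show ?thesis ..
  qed blast
  show ?thesis
    using imp21 imp13 imp32 by blast
qed

end
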